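(* Fix $D>0$ and $G_\sigma>0$, and let $\mathcal R(\rho,\beta)$ be the rate coefficient defined in the context, computed with any $\bar\delta\ge0$. Then for all $\rho>0$ and $\beta>0$, $$\mathcal R(\rho,\beta)\ \ge\ 288\sqrt2\,D\,\sigma_{\mathrm M}^{5/3}\ =\ 288\sqrt2\cdot2^{5/6}\,D\,G_\sigma^{5/3}\,\Lambda^{5/6}.$$ Therefore, for fixed $(D,G_\sigma)$, the exponent $5/6$ of $\Lambda$ in the upper bound $$\mathcal R(\rho^\star,\beta^\star)\le C_{\mathcal R}\,\mathcal L\big(G_\sigma^{1/3}\Lambda^{2/3}+G_\sigma^{2/3}\Lambda^{5/6}\big),\qquad \rho^\star=\sqrt\Lambda,\ \ \beta^\star=2\Lambda G_\sigma^2,$$ is optimal up to logarithms: no choice of $(\rho,\beta)$ makes $\mathcal R(\rho,\beta)$ of smaller polynomial order in $\Lambda$.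
   Context: All quantities are real numbers: $L\ge0$, $G\ge0$, $\widehat G\ge G$, $\bar F\ge0$, $D>0$, $G_\sigma>0$, $T\ge1$, $\tau_{\mathrm{mix}}\ge1$. (In the paper they are, for the problem of minimizing $F=f+h$ over a compact convex $\mathcal X$ from Markovian samples: $L$ the individual smoothness constant; $G$ a common bound for $\|\nabla f\|$ and the Lipschitz constant of $h$ on $\mathcal X$; $\widehat G$ the clipping radius; $D$ the diameter of $\mathcal X$; $\bar F=\sup_{\mathcal X}(F-F^\ast)$, $F^\ast=\min_{\mathcal X}F$; $G_\sigma$ a bound on the centered gradient noise; $T$ the horizon; $\tau_{\mathrm{mix}}$ the mixing time.) Put $$\Lambda=306\,\tau_{\mathrm{mix}}(1+\log_2T),\quad\sigma_{\mathrm M}^2=2\Lambda G_\sigma^2\ (\sigma_{\mathrm M}>0),\quad L_{\mathrm M}^2=2\Lambda L^2 .$$ For $\rho>0$, $\beta>0$ and $\bar\delta\ge0$ define $$\kappa=\Big(2+\tfrac{2\bar\delta^2}{\rho}\Big)^{1/2},\quad \dot B=18(1+\beta+\bar\delta^2),\quad \ddot B=\frac{40L_{\mathrm M}^2\kappa^2}{\rho}\ln(1+\bar\delta^2T),$$ $$Y_1=12D^2\rho^2+144\bar F^2\rho^2,\quad Y_2=96(\dot B+\ddot B),\quad Y_0=\max(2Y_1,Y_2),\quad \vartheta=\frac{\beta^{1/6}}{1+\beta^{1/6}},$$ $$\mathcal R(\rho,\beta)=\frac{2\,Y_0\,\max\big(\beta^{1/3},\vartheta^2,\sigma_{\mathrm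 M}^2\beta^{-2/3}\big)}{\rho\,\vartheta}.$$ $\mathcal R(\rho,\beta)$ is the coefficient of $(T+1)^{-1/3}$ in the paper's bound on the expected average Frank–Wolfe gap. For the upper bound quoted in the claim: it is for $0<G_\sigma\le\overline G_\sigma$ with $\overline G_\sigma>0$ fixed, computed with $\bar\delta=\bar\delta_{\mathrm M}=8(A+2\widehat G\sqrt\Lambda+\rho^\star D)$, $A=LD+2G$; $\mathcal L=\max\{1,\ln(1+\bar\delta_{\mathrm M}^2T)\}=O(\log(\Lambda T))$; and $C_{\mathcal R}=2\cdot2^{1/3}[24D^2+288\bar F^2+1728c_1+7680c_2L^2]$ with $c_1=1+2\overline G_\sigma^2+192(A^2+4\widehat G^2+D^2)$, $c_2=2+384(A^2+4\widehat G^2+D^2)$, so $C_{\mathcal R}$ does not depend on $\Lambda$ or $T$. *)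

theory Defs
  imports Complex_Main "HOL-Library.Landau_Symbols"
begin

text \<open>
  Argument names: \<open>L\<close> smoothness constant, \<open>G\<close> gradient/Lipschitz bound, \<open>Gh\<close> clipping radius,
  \<open>D\<close> diameter, \<open>Fb\<close> bound on the objective gap, \<open>Gs\<close> noise bound, \<open>Gsb\<close> the fixed upper bound
  on \<open>Gs\<close>, \<open>\<tau>\<close> mixing time, \<open>T\<close> horizon, \<open>\<delta>\<close> the quantity written delta-bar on paper.
\<close>

definition Lam :: "real \<Rightarrow> real \<Rightarrow> real" where
  "Lam \<tau> T = 306 * \<tau> * (1 + log 2 T)"

definition sigmaM :: "real \<Rightarrow> real \<Rightarrow> real \<Rightarrow> real" where
  "sigmaM Gs \<tau> T = sqrt (2 * Lam \<tau> T * Gs\<^sup>2)"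

text \<open>\<open>LM_sq\<close> is the square of the Markovian smoothness constant; only the square is ever used.\<close>

definition LM_sq :: "real \<Rightarrow> real \<Rightarrow> real \<Rightarrow> real" where
  "LM_sq L \<tau> T = 2 * Lam \<tau> T * L\<^sup>2"

definition kappa :: "real \<Rightarrow> real \<Rightarrow> real" where
  "kappa \<delta> \<rho> = sqrt (2 + 2 * \<delta>\<^sup>2 / \<rho>)"

definition B_dot :: "real \<Rightarrow> real \<Rightarrow> real" where
  "B_dot \<delta> \<beta> = 18 * (1 + \<beta> + \<delta>\<^sup>2)"

definition B_ddot :: "real \<Rightarrow> real \<Rightarrow> real \<Rightarrow> real \<Rightarrow> real \<Rightarrow> real" where
  "B_ddot L \<tau> T \<delta> \<rho> = 40 * LM_sq L \<tau> T * (kappa \<delta> \<rho>)\<^sup>2 / \<rho> * ln (1 + \<delta>\<^sup>2 * T)"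

definition Y1 :: "real \<Rightarrow> real \<Rightarrow> real \<Rightarrow> real" where
  "Y1 D Fb \<rho> = 12 * D\<^sup>2 * \<rho>\<^sup>2 + 144 * Fb\<^sup>2 * \<rho>\<^sup>2"

definition Y2 :: "real \<Rightarrow> real \<Rightarrow> real \<Rightarrow> real \<Rightarrow> real \<Rightarrow> real \<Rightarrow> real" where
  "Y2 L \<tau> T \<delta> \<rho> \<beta> = 96 * (B_dot \<delta> \<beta> + B_ddot L \<tau> T \<delta> \<rho>)"

definition Y0 :: "real \<Rightarrow> real \<Rightarrow> real \<Rightarrow> real \<Rightarrow> real \<Rightarrow> real \<Rightarrow> real \<Rightarrow> real \<Rightarrow> real" where
  "Y0 L D Fb \<tau> T \<delta> \<rho> \<beta> = max (2 * Y1 D Fb \<rho>) (Y2 L \<tau> T \<delta> \<rho> \<beta>)"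

definition vtheta :: "real \<Rightarrow> real" where
  "vtheta \<beta> = \<beta> powr (1/6) / (1 + \<beta> powr (1/6))"

definition rate_coeff ::
  "real \<Rightarrow> real \<Rightarrow> real \<Rightarrow> real \<Rightarrow> real \<Rightarrow> real \<Rightarrow> real \<Rightarrow> real \<Rightarrow> real \<Rightarrow> real" where
  "rate_coeff L D Fb Gs \<tau> T \<delta> \<rho> \<beta> =
     2 * Y0 L D Fb \<tau> T \<delta> \<rho> \<beta> *
       max (\<beta> powr (1/3)) (max ((vtheta \<beta>)\<^sup>2) ((sigmaM Gs \<tau> T)\<^sup>2 * \<beta> powr (-2/3)))
     / (\<rho> * vtheta \<beta>)"

definition rho_star :: "real \<Rightarrow> real \<Rightarrow> real" where
  "rho_star \<tau> T = sqrt (Lam \<tau> T)"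

definition beta_star :: "real \<Rightarrow> real \<Rightarrow> real \<Rightarrow> real" where
  "beta_star Gs \<tau> T = 2 * Lam \<tau> T * Gs\<^sup>2"

definition A_const :: "real \<Rightarrow> real \<Rightarrow> real \<Rightarrow> real" where
  "A_const L G D = L * D + 2 * G"

definition delta_M :: "real \<Rightarrow> real \<Rightarrow> real \<Rightarrow> real \<Rightarrow> real \<Rightarrow> real \<Rightarrow> real" where
  "delta_M L G Gh D \<tau> T =
     8 * (A_const L G D + 2 * Gh * sqrt (Lam \<tau> T) + rho_star \<tau> T * D)"

definition log_factor :: "real \<Rightarrow> real \<Rightarrow> real \<Rightarrow> real \<Rightarrow> real \<Rightarrow> real \<Rightarrow> real" where
  "log_factor L G Gh D \<tau> T = max 1 (ln (1 + (delta_M L G Gh D \<tau> T)\<^sup>2 * T))"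

definition c1 :: "real \<Rightarrow> real \<Rightarrow> real \<Rightarrow> real \<Rightarrow> real \<Rightarrow> real" where
  "c1 L G Gh D Gsb = 1 + 2 * Gsb\<^sup>2 + 192 * ((A_const L G D)\<^sup>2 + 4 * Gh\<^sup>2 + D\<^sup>2)"

definition c2 :: "real \<Rightarrow> real \<Rightarrow> real \<Rightarrow> real \<Rightarrow> real" where
  "c2 L G Gh D = 2 + 384 * ((A_const L G D)\<^sup>2 + 4 * Gh\<^sup>2 + D\<^sup>2)"

definition C_R :: "real \<Rightarrow> real \<Rightarrow> real \<Rightarrow> real \<Rightarrow> real \<Rightarrow> real \<Rightarrow> real" where
  "C_R L G Gh D Fb Gsb =
     2 * 2 powr (1/3) *
       (24 * D\<^sup>2 + 288 * Fb\<^sup>2 + 1728 * c1 L G Gh D Gsb + 7680 * c2 L G Gh D * L\<^sup>2)"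

end

theory Submission
  imports Defs "HOL-Real_Asymp.Real_Asymp"
begin

text \<open>
  The lower bound uses only three pieces of the rate coefficient. Since \<open>B_ddot\<close> is nonnegative, the
  maximum \<open>Y0\<close> dominates both \<open>24 D\<^sup>2 \<rho>\<^sup>2\<close> and \<open>1728 \<beta>\<close>, hence their geometric mean
  \<open>144 \<surd>2 D \<surd>\<beta> \<rho>\<close> (\<open>Y0_lower\<close>), so the lower bound for \<open>Y0 / \<rho>\<close> does not depend on \<open>\<rho>\<close>. Moreover \<open>vtheta \<beta> \<le> 1\<close>, and it remains to bound
  \<open>\<surd>\<beta> max (\<beta> powr (1/3)) (\<sigma>\<^sup>2 \<beta> powr (-2/3))\<close> from below. The first entry grows in \<open>\<beta>\<close>, the
  second decreases, and they cross at \<open>\<beta> = \<sigma>\<^sup>2\<close>, where the value is \<open>\<sigma> powr (5/3)\<close>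
  (\<open>balance_lower\<close>).

  For the upper bound, at \<open>\<beta> = \<sigma>\<^sup>2\<close> the maximum equals \<open>\<beta> powr (1/3)\<close>, and its quotient by
  \<open>vtheta \<beta>\<close> is \<open>\<beta> powr (1/6) + \<beta> powr (1/3)\<close>; the substitution \<open>\<rho> = \<surd>\<Lambda>\<close> makes \<open>Y0\<close> at most
  linear in \<open>\<Lambda>\<close> up to the logarithmic factor (\<open>Y0_star_upper\<close>), because \<open>delta_M\<close> is of order
  \<open>\<surd>\<Lambda>\<close> (\<open>delta_M_sq_le\<close>). The last estimate also shows that the factor is \<open>O(ln (\<Lambda> T))\<close>.
  Finally, the lower bound is a positive constant times \<open>\<Lambda> powr (5/6)\<close>, which no smaller power
  of \<open>\<Lambda>\<close> can dominate along a sequence with \<open>\<Lambda> \<rightarrow> \<infinity>\<close>.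
\<close>

section \<open>Elementary bounds\<close>

lemma Lam_ge:
  assumes "\<tau> \<ge> 1" "T \<ge> 1"
  shows "Lam \<tau> T \<ge> 306"
proof -
  have "0 \<le> log 2 T" using assms by simp
  then have "1 * 1 \<le> \<tau> * (1 + log 2 T)" using assms by (intro mult_mono) auto
  then show ?thesis unfolding Lam_def by simp
qed

lemma sigmaM_pos:
  assumes "Gs > 0" "\<tau> \<ge> 1" "T \<ge> 1"
  shows "sigmaM Gs \<tau> T > 0"
  using Lam_ge[OF assms(2,3)] assms(1) by (simp add: sigmaM_def)

lemma vtheta_bounds:
  assumes "\<beta> > 0"
  shows "vtheta \<beta> > 0" "vtheta \<beta> \<le> 1" "vtheta \<beta> \<le> \<beta> powr (1/6)"
proof -
  have b: "\<beta> powr (1/6) > 0" using assms by simp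
  then have b1: "1 + \<beta> powr (1/6) > 0" by linarith
  show "vtheta \<beta> > 0" unfolding vtheta_def using b b1 by (rule divide_pos_pos)
  show "vtheta \<beta> \<le> 1" unfolding vtheta_def using b1 by (simp add: divide_le_eq_1_pos)
  have "\<beta> powr (1/6) * 1 \<le> \<beta> powr (1/6) * (1 + \<beta> powr (1/6))"
    using b by (intro mult_left_mono) auto
  then show "vtheta \<beta> \<le> \<beta> powr (1/6)"
    unfolding vtheta_def by (simp add: pos_divide_le_eq[OF b1])
qed

lemma kappa_sq:
  assumes "\<rho> > 0"
  shows "(kappa \<delta> \<rho>)\<^sup>2 = 2 + 2 * \<delta>\<^sup>2 / \<rho>"
  using assms by (simp add: kappa_def)

section \<open>The lower bound\<close>

lemma B_ddot_nonneg:
  assumes "\<tau> \<ge> 1" "T \<ge> 1" "\<rho> > 0"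
  shows "B_ddot L \<tau> T \<delta> \<rho> \<ge> 0"
proof -
  have "ln (1 + \<delta>\<^sup>2 * T) \<ge> 0" using assms by simp
  moreover have "LM_sq L \<tau> T \<ge> 0" using Lam_ge[OF assms(1,2)] by (simp add: LM_sq_def)
  ultimately show ?thesis using assms(3) by (simp add: B_ddot_def)
qed

lemma Y0_lower:
  assumes "D > 0" "\<tau> \<ge> 1" "T \<ge> 1" "\<rho> > 0" "\<beta> > 0"
  shows "Y0 L D Fb \<tau> T \<delta> \<rho> \<beta> \<ge> 144 * sqrt 2 * D * sqrt \<beta> * \<rho>"
proof -
  let ?Y = "Y0 L D Fb \<tau> T \<delta> \<rho> \<beta>"
  have 1: "24 * D\<^sup>2 * \<rho>\<^sup>2 \<le> ?Y"
    by (simp add: Y0_def Y1_def le_max_iff_disj)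
  have "1728 * \<beta> \<le> Y2 L \<tau> T \<delta> \<rho> \<beta>"
    using B_ddot_nonneg[OF assms(2-4), of L \<delta>] by (simp add: Y2_def B_dot_def algebra_simps)
  then have 2: "1728 * \<beta> \<le> ?Y" by (simp add: Y0_def)
  have "(144 * sqrt 2 * D * sqrt \<beta> * \<rho>)\<^sup>2 = (24 * D\<^sup>2 * \<rho>\<^sup>2) * (1728 * \<beta>)"
    using assms by (simp add: power_mult_distrib)
  also have "\<dots> \<le> ?Y * ?Y" using 1 2 assms by (intro mult_mono) (auto intro: order_trans[OF _ 2])
  finally have "(144 * sqrt 2 * D * sqrt \<beta> * \<rho>)\<^sup>2 \<le> ?Y\<^sup>2" by (simp add: power2_eq_square)
  moreover have "?Y \<ge> 0" using 2 assms by simp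
  ultimately show ?thesis by (rule power2_le_imp_le)
qed

text \<open>The case distinction is at the crossing point \<open>\<beta> = s\<^sup>2\<close> of the two entries.\<close>

lemma balance_lower:
  fixes \<beta> s :: real
  assumes "\<beta> > 0" "s > 0"
  shows "s powr (5/3) \<le> sqrt \<beta> * max (\<beta> powr (1/3)) (s\<^sup>2 * \<beta> powr (-2/3))"
proof (cases "s\<^sup>2 \<le> \<beta>")
  case True
  have "s powr (5/3) = (s\<^sup>2) powr (5/6)"
    using assms by (simp add: powr_powr flip: powr_numeral)
  also have "\<dots> \<le> \<beta> powr (5/6)" using True by (intro powr_mono2) auto
  also have "\<dots> = sqrt \<beta> * \<beta> powr (1/3)"
    using assms by (simp add: powr_half_sqrt[symmetric] flip: powr_add)
  also have "\<dots> \<le> sqrt \<beta> * max (\<beta> powr (1/3)) (s\<^sup>2 * \<beta> powr (-2/3))"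
    using assms by (intro mult_left_mono) auto
  finally show ?thesis .
next
  case False
  have "s powr (5/3) = s\<^sup>2 * (s\<^sup>2) powr (-1/6)"
    using assms by (simp add: powr_powr flip: powr_numeral powr_add)
  also have "\<dots> \<le> s\<^sup>2 * \<beta> powr (-1/6)"
    using False assms by (intro mult_left_mono powr_mono2') auto
  also have "\<dots> = sqrt \<beta> * (s\<^sup>2 * \<beta> powr (-2/3))"
    using assms by (simp add: powr_half_sqrt[symmetric] flip: powr_add)
  also have "\<dots> \<le> sqrt \<beta> * max (\<beta> powr (1/3)) (s\<^sup>2 * \<beta> powr (-2/3))"
    using assms by (intro mult_left_mono) auto
  finally show ?thesis .
qed

lemma rate_coeff_lower:
  assumes "D > 0" "Gs > 0" "\<tau> \<ge> 1" "T \<ge> 1" "\<rho> > 0" "\<beta> > 0"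
  shows "rate_coeff L D Fb Gs \<tau> T \<delta> \<rho> \<beta> \<ge> 288 * sqrt 2 * D * sigmaM Gs \<tau> T powr (5/3)"
proof -
  define s where "s = sigmaM Gs \<tau> T"
  define M where "M = max (\<beta> powr (1/3)) (max ((vtheta \<beta>)\<^sup>2) (s\<^sup>2 * \<beta> powr (-2/3)))"
  let ?Y = "Y0 L D Fb \<tau> T \<delta> \<rho> \<beta>"
  have s: "s > 0" using sigmaM_pos assms by (simp add: s_def)
  have th: "vtheta \<beta> > 0" "vtheta \<beta> \<le> 1" using vtheta_bounds assms by auto
  have M: "M \<ge> max (\<beta> powr (1/3)) (s\<^sup>2 * \<beta> powr (-2/3))" by (simp add: M_def)
  have M0: "M \<ge> 0" by (simp add: M_def le_max_iff_disj)
  have "s powr (5/3) \<le> sqrt \<beta> * M"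
    by (rule order_trans[OF balance_lower[OF assms(6) s] mult_left_mono[OF M]]) (use assms in simp)
  then have "288 * sqrt 2 * D * s powr (5/3) \<le> 288 * sqrt 2 * D * (sqrt \<beta> * M)"
    using assms by (intro mult_left_mono) auto
  also have "\<dots> = 2 * (144 * sqrt 2 * D * sqrt \<beta> * \<rho>) * M / \<rho>" using assms by simp
  also have "\<dots> \<le> 2 * ?Y * M / \<rho>"
    using Y0_lower[OF assms(1,3-6), of L Fb \<delta>] M0 assms
    by (intro divide_right_mono mult_right_mono mult_left_mono) auto
  also have "\<dots> \<le> 2 * ?Y * M / (\<rho> * vtheta \<beta>)"
  proof (rule divide_left_mono)
    show "\<rho> * vtheta \<beta> \<le> \<rho>" using th assms by (simp add: mult_left_le)
    have "0 \<le> ?Y" using assms by (intro order_trans[OF _ Y0_lower]) auto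
    then show "0 \<le> 2 * ?Y * M" using M0 by simp
  qed (use th assms in simp)
  finally show ?thesis by (simp add: rate_coeff_def M_def s_def)
qed

lemma sigmaM_powr:
  assumes "Gs > 0" "\<tau> \<ge> 1" "T \<ge> 1"
  shows "sigmaM Gs \<tau> T powr (5/3) = 2 powr (5/6) * Gs powr (5/3) * Lam \<tau> T powr (5/6)"
proof -
  have L: "Lam \<tau> T > 0" using Lam_ge[OF assms(2,3)] by simp
  have "sigmaM Gs \<tau> T powr (5/3) = (2 * Lam \<tau> T * Gs\<^sup>2) powr (5/6)"
    using L by (simp add: sigmaM_def powr_half_sqrt[symmetric] powr_powr)
  also have "\<dots> = 2 powr (5/6) * Lam \<tau> T powr (5/6) * (Gs\<^sup>2) powr (5/6)"
    using L assms by (simp add: powr_mult)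
  also have "(Gs\<^sup>2) powr (5/6) = Gs powr (5/3)"
    using assms by (simp add: powr_powr flip: powr_numeral)
  finally show ?thesis by simp
qed

section \<open>The upper bound at the balanced parameters\<close>

lemma delta_M_sq_le:
  assumes "\<tau> \<ge> 1" "T \<ge> 1"
  shows "(delta_M L G Gh D \<tau> T)\<^sup>2
           \<le> 192 * ((A_const L G D)\<^sup>2 + 4 * Gh\<^sup>2 + D\<^sup>2) * Lam \<tau> T"
proof -
  have sq3: "(a + b + c)\<^sup>2 \<le> 3 * (a\<^sup>2 + b\<^sup>2 + c\<^sup>2)" for a b c :: real
    using sum_squares_ge_zero[of "a - b" "b - c"] zero_le_power2[of "a - c"]
    by (simp add: power2_eq_square algebra_simps)
  define \<Lambda> where "\<Lambda> = Lam \<tau> T"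
  let ?A = "A_const L G D"
  have L: "\<Lambda> \<ge> 306" using Lam_ge assms by (simp add: \<Lambda>_def)
  have "(delta_M L G Gh D \<tau> T)\<^sup>2 = 64 * (?A + 2 * Gh * sqrt \<Lambda> + sqrt \<Lambda> * D)\<^sup>2"
    unfolding delta_M_def rho_star_def \<Lambda>_def power_mult_distrib[of 8] by simp
  also have "\<dots> \<le> 64 * (3 * (?A\<^sup>2 + (2 * Gh * sqrt \<Lambda>)\<^sup>2 + (sqrt \<Lambda> * D)\<^sup>2))"
    by (intro mult_left_mono sq3) simp
  also have "\<dots> = 192 * (?A\<^sup>2 * 1 + (4 * Gh\<^sup>2 + D\<^sup>2) * \<Lambda>)"
    using L by (simp add: power_mult_distrib algebra_simps)
  also have "\<dots> \<le> 192 * (?A\<^sup>2 * \<Lambda> + (4 * Gh\<^sup>2 + D\<^sup>2) * \<Lambda>)"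
    using L by (intro mult_left_mono add_right_mono) auto
  finally show ?thesis by (simp add: \<Lambda>_def algebra_simps)
qed

text \<open>
  At \<open>\<rho> = \<surd>\<Lambda>\<close> the factor \<open>LM_sq \<cdot> kappa\<^sup>2 / \<rho>\<close> of \<open>B_ddot\<close> equals
  \<open>2 L\<^sup>2 (2 \<surd>\<Lambda> + 2 \<delta>\<^sup>2)\<close>, so it too is linear in \<open>\<Lambda>\<close> once \<open>\<delta>\<^sup>2\<close> is.
\<close>

lemma Y0_star_upper:
  assumes "Gs > 0" "Gs \<le> Gsb" "\<tau> \<ge> 1" "T \<ge> 1"
  shows "Y0 L D Fb \<tau> T (delta_M L G Gh D \<tau> T) (rho_star \<tau> T) (beta_star Gs \<tau> T)
    \<le> (24 * D\<^sup>2 + 288 * Fb\<^sup>2 + 1728 * c1 L G Gh D Gsb + 7680 * c2 L G Gh D * L\<^sup>2)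
        * log_factor L G Gh D \<tau> T * Lam \<tau> T"
proof -
  define \<Lambda> where "\<Lambda> = Lam \<tau> T"
  define \<delta> where "\<delta> = delta_M L G Gh D \<tau> T"
  define l where "l = log_factor L G Gh D \<tau> T"
  define C where "C = (A_const L G D)\<^sup>2 + 4 * Gh\<^sup>2 + D\<^sup>2"
  define k1 where "k1 = c1 L G Gh D Gsb"
  define k2 where "k2 = c2 L G Gh D"
  let ?\<rho> = "rho_star \<tau> T" and ?\<beta> = "beta_star Gs \<tau> T"
  have L: "\<Lambda> \<ge> 306" using Lam_ge assms by (simp add: \<Lambda>_def)
  have C: "C \<ge> 0" by (simp add: C_def)
  have kC: "k1 = 1 + 2 * Gsb\<^sup>2 + 192 * C" "k2 = 2 + 384 * C"
    by (simp_all add: k1_def k2_def c1_def c2_def C_def)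
  have k: "k1 \<ge> 0" "k2 \<ge> 0" using C by (simp_all add: kC)
  have l: "l \<ge> 1" "ln (1 + \<delta>\<^sup>2 * T) \<le> l" by (simp_all add: l_def log_factor_def \<delta>_def)
  have \<delta>: "\<delta>\<^sup>2 \<le> 192 * C * \<Lambda>"
    using delta_M_sq_le[OF assms(3,4)] by (simp add: \<delta>_def C_def \<Lambda>_def)
  have \<rho>: "?\<rho> = sqrt \<Lambda>" "sqrt \<Lambda> > 0" using L by (simp_all add: rho_star_def \<Lambda>_def)
  have Y1: "2 * Y1 D Fb ?\<rho> = (24 * D\<^sup>2 + 288 * Fb\<^sup>2) * \<Lambda>"
    using L by (simp add: Y1_def \<rho> algebra_simps)
  have "Gs\<^sup>2 \<le> Gsb\<^sup>2" using assms by (intro power_mono) auto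
  then have "\<Lambda> * Gs\<^sup>2 \<le> \<Lambda> * Gsb\<^sup>2" using L by (intro mult_left_mono) auto
  then have "1 + 2 * (\<Lambda> * Gs\<^sup>2) + \<delta>\<^sup>2 \<le> \<Lambda> + 2 * (\<Lambda> * Gsb\<^sup>2) + 192 * C * \<Lambda>"
    using \<delta> L by linarith
  then have "1 + ?\<beta> + \<delta>\<^sup>2 \<le> k1 * \<Lambda>"
    by (simp add: kC beta_star_def algebra_simps flip: \<Lambda>_def)
  then have B1: "B_dot \<delta> ?\<beta> \<le> 18 * (k1 * \<Lambda>)" by (simp add: B_dot_def)
  have "sqrt \<Lambda> \<le> sqrt (\<Lambda>\<^sup>2)" using L by (intro real_sqrt_le_mono) (simp add: power2_eq_square)
  then have "sqrt \<Lambda> \<le> \<Lambda>" using L by simp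
  then have k2: "2 * sqrt \<Lambda> + 2 * \<delta>\<^sup>2 \<le> k2 * \<Lambda>"
    using \<delta> by (simp add: kC algebra_simps)
  have "\<Lambda> / sqrt \<Lambda> = sqrt \<Lambda>" using L by (simp add: real_div_sqrt)
  then have "(2 + 2 * \<delta>\<^sup>2 / sqrt \<Lambda>) * (\<Lambda> / sqrt \<Lambda>) = 2 * sqrt \<Lambda> + 2 * \<delta>\<^sup>2"
    using \<rho>(2) by (simp add: field_simps)
  moreover have "B_ddot L \<tau> T \<delta> ?\<rho>
      = 80 * L\<^sup>2 * ((2 + 2 * \<delta>\<^sup>2 / sqrt \<Lambda>) * (\<Lambda> / sqrt \<Lambda>)) * ln (1 + \<delta>\<^sup>2 * T)"
    using \<rho> by (simp add: B_ddot_def LM_sq_def kappa_sq \<Lambda>_def)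
  ultimately have "B_ddot L \<tau> T \<delta> ?\<rho> = 80 * L\<^sup>2 * (2 * sqrt \<Lambda> + 2 * \<delta>\<^sup>2) * ln (1 + \<delta>\<^sup>2 * T)"
    by simp
  also have "\<dots> \<le> 80 * L\<^sup>2 * (k2 * \<Lambda>) * l"
    using l k2 k L assms by (intro mult_mono mult_left_mono) auto
  finally have B2: "B_ddot L \<tau> T \<delta> ?\<rho> \<le> 80 * L\<^sup>2 * (k2 * \<Lambda>) * l" .
  \<comment> \<open>The terms of \<open>Y0\<close> without a logarithm absorb the factor \<open>l\<close> because \<open>l \<ge> 1\<close>.\<close>
  have pad: "x \<le> x * l" if "x \<ge> 0" for x :: real
    using that l by (simp add: mult_le_cancel_left1)
  have "18 * (k1 * \<Lambda>) \<le> 18 * (k1 * \<Lambda>) * l" using k L by (intro pad) auto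
  then have Y2: "Y2 L \<tau> T \<delta> ?\<rho> ?\<beta> \<le> (1728 * k1 + 7680 * k2 * L\<^sup>2) * l * \<Lambda>"
    using B1 B2 by (simp add: Y2_def algebra_simps)
  have "(24 * D\<^sup>2 + 288 * Fb\<^sup>2) * \<Lambda> \<le> (24 * D\<^sup>2 + 288 * Fb\<^sup>2) * \<Lambda> * l"
    using L by (intro pad) auto
  moreover have "0 \<le> (1728 * k1 + 7680 * k2 * L\<^sup>2) * l * \<Lambda>"
    "0 \<le> (24 * D\<^sup>2 + 288 * Fb\<^sup>2) * \<Lambda> * l"
    using k l L by auto
  ultimately have "max (2 * Y1 D Fb ?\<rho>) (Y2 L \<tau> T \<delta> ?\<rho> ?\<beta>)
      \<le> (24 * D\<^sup>2 + 288 * Fb\<^sup>2) * \<Lambda> * l + (1728 * k1 + 7680 * k2 * L\<^sup>2) * l * \<Lambda>"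
    using Y1 Y2 by linarith
  then show ?thesis
    unfolding Y0_def \<delta>_def[symmetric] l_def[symmetric] k1_def[symmetric] k2_def[symmetric]
      \<Lambda>_def[symmetric] by (simp add: algebra_simps)
qed

lemma rate_coeff_at_star:
  assumes "Gs > 0" "\<tau> \<ge> 1" "T \<ge> 1"
  shows "rate_coeff L D Fb Gs \<tau> T \<delta> \<rho> (beta_star Gs \<tau> T)
    = 2 * Y0 L D Fb \<tau> T \<delta> \<rho> (beta_star Gs \<tau> T) / \<rho>
        * (beta_star Gs \<tau> T powr (1/6) + beta_star Gs \<tau> T powr (1/3))"
proof -
  define \<beta> where "\<beta> = beta_star Gs \<tau> T"
  define b where "b = \<beta> powr (1/6)"
  have \<beta>: "\<beta> > 0" using Lam_ge[OF assms(2,3)] assms by (simp add: \<beta>_def beta_star_def)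
  have b: "b > 0" using \<beta> by (simp add: b_def)
  have b2: "\<beta> powr (1/3) = b\<^sup>2"
    using \<beta> by (simp add: b_def power2_eq_square flip: powr_add)
  have "(sigmaM Gs \<tau> T)\<^sup>2 = \<beta>"
    using \<beta> by (simp add: sigmaM_def \<beta>_def beta_star_def)
  then have s: "(sigmaM Gs \<tau> T)\<^sup>2 * \<beta> powr (-2/3) = b\<^sup>2"
    using \<beta> by (simp add: powr_mult_base flip: b2)
  have th: "vtheta \<beta> > 0" "vtheta \<beta> \<le> b" using vtheta_bounds[OF \<beta>] by (simp_all add: b_def)
  then have "(vtheta \<beta>)\<^sup>2 \<le> b\<^sup>2" by (intro power_mono) auto
  \<comment> \<open>With \<open>b = \<beta> powr (1/6)\<close> and \<open>\<sigma>\<^sup>2 = \<beta>\<close>, the outer entries coincide and dominate the middle one.\<close>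
  then have M: "max (\<beta> powr (1/3)) (max ((vtheta \<beta>)\<^sup>2) ((sigmaM Gs \<tau> T)\<^sup>2 * \<beta> powr (-2/3))) = b\<^sup>2"
    unfolding s b2 by simp
  have "b\<^sup>2 / vtheta \<beta> = b + b\<^sup>2"
    using b by (simp add: vtheta_def power2_eq_square field_simps flip: b_def)
  then have "2 * Y * b\<^sup>2 / (\<rho> * vtheta \<beta>) = 2 * Y / \<rho> * (b + b\<^sup>2)" for Y
    by (simp only: times_divide_times_eq[symmetric])
  then show ?thesis
    unfolding rate_coeff_def \<beta>_def[symmetric] M unfolding b2 b_def[symmetric] by simp
qed

lemma rate_coeff_star_upper:
  assumes "Gs > 0" "Gs \<le> Gsb" "\<tau> \<ge> 1" "T \<ge> 1"
  shows "rate_coeff L D Fb Gs \<tau> T (delta_M L G Gh D \<tau> T) (rho_star \<tau> T) (beta_star Gs \<tau> T)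
    \<le> C_R L G Gh D Fb Gsb * log_factor L G Gh D \<tau> T
         * (Gs powr (1/3) * Lam \<tau> T powr (2/3) + Gs powr (2/3) * Lam \<tau> T powr (5/6))"
proof -
  define \<Lambda> where "\<Lambda> = Lam \<tau> T"
  define l where "l = log_factor L G Gh D \<tau> T"
  define K where "K = 24 * D\<^sup>2 + 288 * Fb\<^sup>2 + 1728 * c1 L G Gh D Gsb + 7680 * c2 L G Gh D * L\<^sup>2"
  define Y where "Y = Y0 L D Fb \<tau> T (delta_M L G Gh D \<tau> T) (rho_star \<tau> T) (beta_star Gs \<tau> T)"
  let ?\<beta> = "beta_star Gs \<tau> T"
  define E where "E = Gs powr (1/3) * \<Lambda> powr (1/6) + Gs powr (2/3) * \<Lambda> powr (1/3)"
  have L: "\<Lambda> \<ge> 306" using Lam_ge assms by (simp add: \<Lambda>_def)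
  have \<rho>: "rho_star \<tau> T = sqrt \<Lambda>" "sqrt \<Lambda> > 0" using L by (simp_all add: rho_star_def \<Lambda>_def)
  have l: "l \<ge> 1" by (simp add: l_def log_factor_def)
  have K: "K \<ge> 0" by (simp add: K_def c1_def c2_def)
  have Gs2: "(Gs\<^sup>2) powr a = Gs powr (2 * a)" for a
    using assms by (simp add: powr_powr flip: powr_numeral)
  have bp: "?\<beta> powr a = 2 powr a * (Gs powr (2 * a) * \<Lambda> powr a)" for a
    using L assms by (simp add: beta_star_def powr_mult Gs2 flip: \<Lambda>_def)
  have "2 powr (1/6) * (Gs powr (1/3) * \<Lambda> powr (1/6))
      \<le> 2 powr (1/3) * (Gs powr (1/3) * \<Lambda> powr (1/6))"
    by (intro mult_right_mono powr_mono) auto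
  then have E: "?\<beta> powr (1/6) + ?\<beta> powr (1/3) \<le> 2 powr (1/3) * E"
    by (simp add: bp E_def algebra_simps)
  have sE: "sqrt \<Lambda> * E = Gs powr (1/3) * \<Lambda> powr (2/3) + Gs powr (2/3) * \<Lambda> powr (5/6)"
  proof -
    have "sqrt \<Lambda> * \<Lambda> powr (1/6) = \<Lambda> powr (2/3)" "sqrt \<Lambda> * \<Lambda> powr (1/3) = \<Lambda> powr (5/6)"
      using L by (simp_all add: powr_half_sqrt[symmetric] flip: powr_add)
    then show ?thesis
      unfolding E_def distrib_left mult.left_commute[of "sqrt \<Lambda>"] by simp
  qed
  have "Y \<le> K * l * \<Lambda>"
    using Y0_star_upper[OF assms] by (simp add: Y_def K_def l_def \<Lambda>_def)
  then have "2 * Y / sqrt \<Lambda> \<le> 2 * (K * l * \<Lambda>) / sqrt \<Lambda>"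
    using \<rho> by (intro divide_right_mono) auto
  also have "\<dots> = 2 * K * l * (\<Lambda> / sqrt \<Lambda>)" by simp
  also have "\<Lambda> / sqrt \<Lambda> = sqrt \<Lambda>" using L by (simp add: real_div_sqrt)
  finally have Y: "2 * Y / sqrt \<Lambda> \<le> 2 * K * l * sqrt \<Lambda>" .
  have "rate_coeff L D Fb Gs \<tau> T (delta_M L G Gh D \<tau> T) (rho_star \<tau> T) ?\<beta>
      = 2 * Y / sqrt \<Lambda> * (?\<beta> powr (1/6) + ?\<beta> powr (1/3))"
    unfolding rate_coeff_at_star[OF assms(1,3,4)] Y_def \<rho>(1) ..
  also have "\<dots> \<le> 2 * K * l * sqrt \<Lambda> * (2 powr (1/3) * E)"
    using Y E K l \<rho>(2) by (intro mult_mono) auto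
  also have "\<dots> = 2 * 2 powr (1/3) * K * l * (sqrt \<Lambda> * E)" by simp
  finally show ?thesis
    unfolding sE by (simp add: C_R_def K_def l_def \<Lambda>_def)
qed

lemma log_factor_bound:
  "\<exists>K. \<forall>\<tau> T :: real. \<tau> \<ge> 1 \<longrightarrow> T \<ge> 1 \<longrightarrow> log_factor L G Gh D \<tau> T \<le> K * ln (Lam \<tau> T * T)"
proof -
  define C where "C = 1 + 192 * ((A_const L G D)\<^sup>2 + 4 * Gh\<^sup>2 + D\<^sup>2)"
  have C: "C \<ge> 1" by (simp add: C_def)
  have "log_factor L G Gh D \<tau> T \<le> (ln C + 1) * ln (Lam \<tau> T * T)"
    if T: "\<tau> \<ge> 1" "T \<ge> 1" for \<tau> T
  proof -
    define P where "P = Lam \<tau> T * T"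
    have "306 * 1 \<le> Lam \<tau> T * T" using Lam_ge[OF T] T by (intro mult_mono) auto
    then have P: "P \<ge> 306" by (simp add: P_def)
    have "exp 1 \<le> P" using P exp_le by linarith
    then have lP: "ln P \<ge> 1" using P by (simp add: ln_ge_iff)
    have "(delta_M L G Gh D \<tau> T)\<^sup>2 * T \<le> (C - 1) * Lam \<tau> T * T"
      using delta_M_sq_le[OF T, of L G Gh D] T by (intro mult_right_mono) (auto simp: C_def)
    then have "1 + (delta_M L G Gh D \<tau> T)\<^sup>2 * T \<le> C * P"
      using P by (simp add: P_def algebra_simps)
    moreover have "0 < 1 + (delta_M L G Gh D \<tau> T)\<^sup>2 * T"
      using T by (intro add_pos_nonneg) auto
    ultimately have "ln (1 + (delta_M L G Gh D \<tau> T)\<^sup>2 * T) \<le> ln (C * P)"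
      using C P by simp
    also have "\<dots> = ln C + ln P" using C P by (simp add: ln_mult)
    also have "ln C * 1 \<le> ln C * ln P" using lP C by (intro mult_left_mono) auto
    then have "ln C + ln P \<le> (ln C + 1) * ln P" by (simp add: algebra_simps)
    finally have "ln (1 + (delta_M L G Gh D \<tau> T)\<^sup>2 * T) \<le> (ln C + 1) * ln P" .
    moreover have "1 * 1 \<le> (ln C + 1) * ln P" using lP C by (intro mult_mono) auto
    ultimately show ?thesis by (simp add: log_factor_def P_def)
  qed
  then show ?thesis by blast
qed

section \<open>Optimality of the exponent\<close>

lemma not_bigo_of_powr_lower:
  fixes f g :: "nat \<Rightarrow> real"
  assumes "c > 0" "p < q" and lower: "\<And>n. c * g n powr q \<le> f n"
    and g: "filterlim g at_top sequentially"
  shows "f \<notin> O(\<lambda>n. g n powr p)"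
proof
  assume "f \<in> O(\<lambda>n. g n powr p)"
  then obtain K where K: "eventually (\<lambda>n. norm (f n) \<le> K * norm (g n powr p)) sequentially"
    by (elim landau_o.bigE)
  have "filterlim (\<lambda>n. g n powr (q - p)) at_top sequentially"
  proof (rule filterlim_compose[OF _ g])
    show "filterlim (\<lambda>x::real. x powr (q - p)) at_top at_top"
      using assms(2) by real_asymp
  qed
  then have "eventually (\<lambda>n. g n powr (q - p) > K / c) sequentially"
    by (simp add: filterlim_at_top_dense)
  moreover have "eventually (\<lambda>n. g n > 0) sequentially"
    using g by (simp add: filterlim_at_top_dense)
  ultimately have "eventually (\<lambda>n. False) sequentially"
    using K
  proof eventually_elim
    case (elim n)
    have "K < c * g n powr (q - p)" using elim(1) assms(1) by (simp add: field_simps)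
    then have "K * g n powr p < c * g n powr (q - p) * g n powr p" using elim(2) by simp
    also have "\<dots> = c * g n powr q" using elim(2) by (simp flip: powr_add)
    also have "\<dots> \<le> f n" by (rule lower)
    finally show False using elim(3) by simp
  qed
  then show False by simp
qed

theorem theorem5p9:
  fixes D Gs :: real
  assumes "D > 0" and "Gs > 0"
  shows
    "(\<forall>L Fb \<tau> T \<delta> \<rho> \<beta> :: real.
        L \<ge> 0 \<longrightarrow> Fb \<ge> 0 \<longrightarrow> \<tau> \<ge> 1 \<longrightarrow> T \<ge> 1 \<longrightarrow> \<delta> \<ge> 0 \<longrightarrow> \<rho> > 0 \<longrightarrow> \<beta> > 0 \<longrightarrow>
          rate_coeff L D Fb Gs \<tau> T \<delta> \<rho> \<beta> \<ge> 288 * sqrt 2 * D * sigmaM Gs \<tau> T powr (5/3) \<and>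
          288 * sqrt 2 * D * sigmaM Gs \<tau> T powr (5/3)
            = 288 * sqrt 2 * 2 powr (5/6) * D * Gs powr (5/3) * Lam \<tau> T powr (5/6))
     \<and> (\<forall>L G Gh Fb Gsb \<tau> T :: real.
        L \<ge> 0 \<longrightarrow> G \<ge> 0 \<longrightarrow> Gh \<ge> G \<longrightarrow> Fb \<ge> 0 \<longrightarrow> Gs \<le> Gsb \<longrightarrow> \<tau> \<ge> 1 \<longrightarrow> T \<ge> 1 \<longrightarrow>
          rate_coeff L D Fb Gs \<tau> T (delta_M L G Gh D \<tau> T) (rho_star \<tau> T) (beta_star Gs \<tau> T)
            \<le> C_R L G Gh D Fb Gsb * log_factor L G Gh D \<tau> T
               * (Gs powr (1/3) * Lam \<tau> T powr (2/3) + Gs powr (2/3) * Lam \<tau> T powr (5/6)))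
     \<and> (\<forall>L G Gh :: real. L \<ge> 0 \<longrightarrow> G \<ge> 0 \<longrightarrow> Gh \<ge> G \<longrightarrow>
          (\<exists>K. \<forall>\<tau> T :: real. \<tau> \<ge> 1 \<longrightarrow> T \<ge> 1 \<longrightarrow>
             log_factor L G Gh D \<tau> T \<le> K * ln (Lam \<tau> T * T)))
     \<and> (\<forall>(p :: real) (L :: nat \<Rightarrow> real) (Fb :: nat \<Rightarrow> real) (\<tau> :: nat \<Rightarrow> real) (T :: nat \<Rightarrow> real)
          (\<delta> :: nat \<Rightarrow> real) (\<rho> :: nat \<Rightarrow> real) (\<beta> :: nat \<Rightarrow> real).
        p < 5/6 \<longrightarrow>
        (\<forall>n. L n \<ge> 0 \<and> Fb n \<ge> 0 \<and> \<tau> n \<ge> 1 \<and> T n \<ge> 1 \<and> \<delta> n \<ge> 0 \<and> \<rho> n > 0 \<and> \<beta> n > 0) \<longrightarrow>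
        filterlim (\<lambda>n. Lam (\<tau> n) (T n)) at_top sequentially \<longrightarrow>
          (\<lambda>n. rate_coeff (L n) D (Fb n) Gs (\<tau> n) (T n) (\<delta> n) (\<rho> n) (\<beta> n))
            \<notin> O(\<lambda>n. Lam (\<tau> n) (T n) powr p))"
proof (intro conjI allI impI)
  fix L Fb \<tau> T \<delta> \<rho> \<beta> :: real
  assume "\<tau> \<ge> 1" "T \<ge> 1" "\<rho> > 0" "\<beta> > 0"
  then show "rate_coeff L D Fb Gs \<tau> T \<delta> \<rho> \<beta> \<ge> 288 * sqrt 2 * D * sigmaM Gs \<tau> T powr (5/3)"
    and "288 * sqrt 2 * D * sigmaM Gs \<tau> T powr (5/3)
            = 288 * sqrt 2 * 2 powr (5/6) * D * Gs powr (5/3) * Lam \<tau> T powr (5/6)"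
    using rate_coeff_lower sigmaM_powr assms by simp_all
next
  fix L G Gh Fb Gsb \<tau> T :: real
  assume "Gs \<le> Gsb" "\<tau> \<ge> 1" "T \<ge> 1"
  then show "rate_coeff L D Fb Gs \<tau> T (delta_M L G Gh D \<tau> T) (rho_star \<tau> T) (beta_star Gs \<tau> T)
      \<le> C_R L G Gh D Fb Gsb * log_factor L G Gh D \<tau> T
         * (Gs powr (1/3) * Lam \<tau> T powr (2/3) + Gs powr (2/3) * Lam \<tau> T powr (5/6))"
    using rate_coeff_star_upper assms by blast
next
  fix L G Gh :: real
  show "\<exists>K. \<forall>\<tau> T :: real. \<tau> \<ge> 1 \<longrightarrow> T \<ge> 1 \<longrightarrow> log_factor L G Gh D \<tau> T \<le> K * ln (Lam \<tau> T * T)"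
    by (rule log_factor_bound)
next
  fix p :: real and L Fb \<tau> T \<delta> \<rho> \<beta> :: "nat \<Rightarrow> real"
  assume p: "p < 5/6"
    and par: "\<forall>n. L n \<ge> 0 \<and> Fb n \<ge> 0 \<and> \<tau> n \<ge> 1 \<and> T n \<ge> 1 \<and> \<delta> n \<ge> 0 \<and> \<rho> n > 0 \<and> \<beta> n > 0"
    and lim: "filterlim (\<lambda>n. Lam (\<tau> n) (T n)) at_top sequentially"
  define c where "c = 288 * sqrt 2 * D * (2 powr (5/6) * Gs powr (5/3))"
  have c: "c > 0" using assms by (simp add: c_def)
  have "c * Lam (\<tau> n) (T n) powr (5/6)
      \<le> rate_coeff (L n) D (Fb n) Gs (\<tau> n) (T n) (\<delta> n) (\<rho> n) (\<beta> n)" for n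
    using rate_coeff_lower[of D Gs "\<tau> n" "T n" "\<rho> n" "\<beta> n" "L n" "Fb n" "\<delta> n"]
      sigmaM_powr[of Gs "\<tau> n" "T n"] par assms by (simp add: c_def mult.assoc)
  then show "(\<lambda>n. rate_coeff (L n) D (Fb n) Gs (\<tau> n) (T n) (\<delta> n) (\<rho> n) (\<beta> n))
            \<notin> O(\<lambda>n. Lam (\<tau> n) (T n) powr p)"
    by (rule not_bigo_of_powr_lower[OF c p _ lim])
qed

end
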